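(* Let $X$ be a space (a strongly discrete metric space with bounded geometry), $E$ a Banach space, $\omega$ a non-principal ultrafilter on $X$ and $p\in\{0,1,\infty\}$. Then the set of band operators on $\ell^p_E(X)$ that are rich at $\omega$ is dense (in operator norm) in $\mathcal A^p_E(X)^{\$,\omega}$, the set of band-dominated operators on $\ell^p_E(X)$ rich at $\omega$; and the set of rich band operators on $\ell^p_E(X)$ is dense in $\mathcal A^p_E(X)^{\$}$, the set of rich band-dominated operators on $\ell^p_E(X)$.
   Context: A metric space $X$ has bounded geometry if $\sup_{x\in X}\sharp B(x,R)<\infty$ for every $R$; it is strongly discrete if $\{d(x,y):x,y\in X\}$ is a discrete subset of $\mathbb R$. $\ell^1_E(X)$ is the Banach space of absolutely summable functions $X\to E$; $\ell^\infty_E(X)$ that of bounded functions $X\to E$; $\ell^0_E(X)=c_0(X;E)$ that of functions vanishing at infinity with sup norm. For an operator $T$ on $\ell^p_E(X)$ and $x,y\in X$, the matrix coefficient $T_{xy}\in\mathfrak B(E)$ is $T_{xy}e=(T(e\delta_y))(x)$, where $e\delta_y$ takes value $e$ at $y$ and $0$ elsewhere ($\mathfrak B(Y)$ denotes bounded linear operators on $Y$). A band operator is an $X$-by-$X$ matrix $[A_{xy}]$ with entries in $\mathfrak B(E)$ such that $\sup_{x,y}\|A_{xy}\|<\infty$ and $\mathrm{prop}(A)=\sup\{d(x,y):A_{xy}\neq0\}<\infty$; it acts as a bounded operator on $\ell^p_E(X)$ by matrix multiplication. Band-dominated operators on $\ell^p_E(X)$ are the elements of $\mathcal A^p_E(X)$,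 the norm closure of the band operators in $\mathfrak B(\ell^p_E(X))$. $\beta X$ is the set of ultrafilters on $X$ (viewed as $\{0,1\}$-valued finitely additive measures) and $\partial X=\beta X\setminus X$ is the set of non-principal ultrafilters. A partial translation is a bijection $t:D\to R$ between subsets of $X$ with $\sup_{x\in D}d(x,t(x))<\infty$; it is compatible with an ultrafilter $\omega$ if $\omega(D)=1$. $A\in\mathcal A^p_E(X)$ is rich at $\omega\in\partial X$ if for all partial translations $t,s$ compatible with $\omega$, $\lim_{x\to\omega}A_{t(x)s(x)}$ exists in the norm of $\mathfrak B(E)$; $A$ is rich if it is rich at all $\omega\in\partial X$. *)

theory Defs
  imports "HOL-Analysis.Analysis"
begin

section \<open>Spaces\<close>

definition bounded_geometry :: "'x::metric_space set \<Rightarrow> bool" where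
  "bounded_geometry X \<longleftrightarrow>
     (\<forall>R::real. \<exists>N::nat. \<forall>x\<in>X. finite (X \<inter> cball x R) \<and> card (X \<inter> cball x R) \<le> N)"

definition strongly_discrete :: "'x::metric_space set \<Rightarrow> bool" where
  "strongly_discrete X \<longleftrightarrow> discrete {dist x y |x y. x \<in> X \<and> y \<in> X}"

section \<open>Coefficient spaces\<close>

text \<open>
  The class \<^class>\<open>banach\<close> only records the real structure of a Banach space. A Banach space over
  the real or complex numbers is a space of this class together with a compatible scalar
  multiplication \<open>sc\<close> by a field \<open>'k\<close> of class \<^class>\<open>real_normed_field\<close> (whose norm is
  multiplicative, so that \<open>'k\<close> is necessarily a copy of the real or of the complex numbers).
  Real Banach spaces are the case where \<open>sc\<close> is \<^const>\<open>scaleR\<close>.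
\<close>

definition banach_scalars :: "('k::real_normed_field \<Rightarrow> 'e::banach \<Rightarrow> 'e) \<Rightarrow> bool" where
  "banach_scalars sc \<longleftrightarrow>
     vector_space sc \<and>
     (\<forall>r e. sc (of_real r) e = r *\<^sub>R e) \<and>
     (\<forall>c e. norm (sc c e) = norm c * norm e)"

text \<open>The algebra of bounded operators on \<open>E\<close>: the bounded operators that are linear over \<open>'k\<close>.\<close>

definition bounded_ops_E :: "('k::real_normed_field \<Rightarrow> 'e::banach \<Rightarrow> 'e) \<Rightarrow> ('e \<Rightarrow>\<^sub>L 'e) set" where
  "bounded_ops_E sc = {a. \<forall>c e. blinfun_apply a (sc c e) = sc c (blinfun_apply a e)}"

section \<open>The spaces of functions and their bounded operators\<close>

datatype exponent = P0 | P1 | PInf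

text \<open>
  For \<^const>\<open>P0\<close>, vanishing at infinity means convergence to 0 along the complements of finite sets:
  in a space of bounded geometry bounded sets are finite.
\<close>

primrec ell :: "exponent \<Rightarrow> ('x \<Rightarrow> 'e::real_normed_vector) set" where
  "ell P0 = {f. (f \<longlongrightarrow> 0) cofinite}"
| "ell P1 = {f. f abs_summable_on UNIV}"
| "ell PInf = {f. bounded (range f)}"

primrec ell_norm :: "exponent \<Rightarrow> ('x \<Rightarrow> 'e::real_normed_vector) \<Rightarrow> real" where
  "ell_norm P0 f = (SUP x. norm (f x))"
| "ell_norm P1 f = (\<Sum>\<^sub>\<infinity>x. norm (f x))"
| "ell_norm PInf f = (SUP x. norm (f x))"

text \<open>
  Operators on \<^term>\<open>ell p\<close> are functions that are \<^const>\<open>undefined\<close> outside \<^term>\<open>ell p\<close>, so that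
  equality of such functions is equality of operators.
\<close>

definition bounded_ops ::
  "('k::real_normed_field \<Rightarrow> 'e::banach \<Rightarrow> 'e) \<Rightarrow> exponent \<Rightarrow> (('x \<Rightarrow> 'e) \<Rightarrow> ('x \<Rightarrow> 'e)) set" where
  "bounded_ops sc p = {T.
     T \<in> extensional (ell p) \<and>
     (\<forall>f\<in>ell p. T f \<in> ell p) \<and>
     (\<forall>f\<in>ell p. \<forall>g\<in>ell p. T (\<lambda>x. f x + g x) = (\<lambda>x. T f x + T g x)) \<and>
     (\<forall>c. \<forall>f\<in>ell p. T (\<lambda>x. sc c (f x)) = (\<lambda>x. sc c (T f x))) \<and>
     (\<exists>C. \<forall>f\<in>ell p. ell_norm p (T f) \<le> C * ell_norm p f)}"

text \<open>As for \<^const>\<open>onorm\<close>, the quotient is 0 for the zero function.\<close>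

definition op_norm ::
  "exponent \<Rightarrow> (('x \<Rightarrow> 'e::real_normed_vector) \<Rightarrow> ('x \<Rightarrow> 'e)) \<Rightarrow> real" where
  "op_norm p T = (SUP f\<in>ell p. ell_norm p (T f) / ell_norm p f)"

definition norm_closure ::
  "('k::real_normed_field \<Rightarrow> 'e::banach \<Rightarrow> 'e) \<Rightarrow> exponent \<Rightarrow>
     (('x \<Rightarrow> 'e) \<Rightarrow> ('x \<Rightarrow> 'e)) set \<Rightarrow> (('x \<Rightarrow> 'e) \<Rightarrow> ('x \<Rightarrow> 'e)) set" where
  "norm_closure sc p S =
     {T \<in> bounded_ops sc p. \<forall>\<epsilon>>0. \<exists>B\<in>S. op_norm p (\<lambda>f x. T f x - B f x) < \<epsilon>}"

definition norm_dense_in ::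
  "('k::real_normed_field \<Rightarrow> 'e::banach \<Rightarrow> 'e) \<Rightarrow> exponent \<Rightarrow>
     (('x \<Rightarrow> 'e) \<Rightarrow> ('x \<Rightarrow> 'e)) set \<Rightarrow> (('x \<Rightarrow> 'e) \<Rightarrow> ('x \<Rightarrow> 'e)) set \<Rightarrow> bool" where
  "norm_dense_in sc p D S \<longleftrightarrow> D \<subseteq> S \<and> S \<subseteq> norm_closure sc p D"

section \<open>Band-dominated operators\<close>

definition delta :: "'x \<Rightarrow> 'e::zero \<Rightarrow> 'x \<Rightarrow> 'e" where
  "delta y e = (\<lambda>_. 0)(y := e)"

definition matrix_coeff ::
  "(('x \<Rightarrow> 'e::banach) \<Rightarrow> ('x \<Rightarrow> 'e)) \<Rightarrow> 'x \<Rightarrow> 'x \<Rightarrow> ('e \<Rightarrow>\<^sub>L 'e)" where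
  "matrix_coeff T x y = Blinfun (\<lambda>e. T (delta y e) x)"

definition band_matrix ::
  "('k::real_normed_field \<Rightarrow> 'e::banach \<Rightarrow> 'e) \<Rightarrow>
     ('x::metric_space \<Rightarrow> 'x \<Rightarrow> ('e \<Rightarrow>\<^sub>L 'e)) \<Rightarrow> bool" where
  "band_matrix sc A \<longleftrightarrow>
     (\<forall>x y. A x y \<in> bounded_ops_E sc) \<and>
     bdd_above {norm (A x y) |x y. True} \<and>
     bdd_above {dist x y |x y. A x y \<noteq> 0}"

text \<open>
  The sum below is finite for a band matrix over a space of bounded geometry.
\<close>

definition matrix_op ::
  "exponent \<Rightarrow> ('x \<Rightarrow> 'x \<Rightarrow> ('e::banach \<Rightarrow>\<^sub>L 'e)) \<Rightarrow> ('x \<Rightarrow> 'e) \<Rightarrow> ('x \<Rightarrow> 'e)" where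
  "matrix_op p A =
     restrict (\<lambda>f x. \<Sum>y | A x y \<noteq> 0. blinfun_apply (A x y) (f y)) (ell p)"

definition band_ops ::
  "('k::real_normed_field \<Rightarrow> 'e::banach \<Rightarrow> 'e) \<Rightarrow> exponent \<Rightarrow>
     (('x::metric_space \<Rightarrow> 'e) \<Rightarrow> ('x \<Rightarrow> 'e)) set" where
  "band_ops sc p = matrix_op p ` {A. band_matrix sc A}"

definition band_dominated ::
  "('k::real_normed_field \<Rightarrow> 'e::banach \<Rightarrow> 'e) \<Rightarrow> exponent \<Rightarrow>
     (('x::metric_space \<Rightarrow> 'e) \<Rightarrow> ('x \<Rightarrow> 'e)) set" where
  "band_dominated sc p = norm_closure sc p (band_ops sc p)"

section \<open>Richness\<close>

text \<open>
  Ultrafilters on \<open>X\<close> are represented as filters: the associated finitely additive measure gives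
  mass 1 to \<open>D\<close> iff \<open>\<forall>\<^sub>F x in \<omega>. x \<in> D\<close>, and \<open>lim\<^sub>x\<^sub>\<rightarrow>\<^sub>\<omega>\<close> is the limit along this filter.
\<close>

definition ultrafilters :: "'x filter set" where
  "ultrafilters = {\<omega>. \<omega> \<noteq> bot \<and> (\<forall>P. eventually P \<omega> \<or> eventually (\<lambda>x. \<not> P x) \<omega>)}"

definition nonprincipal_ultrafilters :: "'x filter set" where
  "nonprincipal_ultrafilters = ultrafilters - range (\<lambda>x. principal {x})"

text \<open>A partial translation \<open>t : D \<rightarrow> R\<close>; the values of \<open>t\<close> outside \<open>D\<close> are irrelevant.\<close>

definition partial_translation :: "'x::metric_space set \<Rightarrow> 'x set \<Rightarrow> ('x \<Rightarrow> 'x) \<Rightarrow> bool" where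
  "partial_translation D R t \<longleftrightarrow> bij_betw t D R \<and> bdd_above ((\<lambda>x. dist x (t x)) ` D)"

definition compatible :: "'x set \<Rightarrow> 'x filter \<Rightarrow> bool" where
  "compatible D \<omega> \<longleftrightarrow> (\<forall>\<^sub>F x in \<omega>. x \<in> D)"

definition rich_at ::
  "(('x::metric_space \<Rightarrow> 'e::banach) \<Rightarrow> ('x \<Rightarrow> 'e)) \<Rightarrow> 'x filter \<Rightarrow> bool" where
  "rich_at A \<omega> \<longleftrightarrow>
     (\<forall>D R t D' R' s.
        partial_translation D R t \<and> compatible D \<omega> \<and>
        partial_translation D' R' s \<and> compatible D' \<omega> \<longrightarrow>
        (\<exists>L. ((\<lambda>x. matrix_coeff A (t x) (s x)) \<longlongrightarrow> L) \<omega>))"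

definition rich :: "(('x::metric_space \<Rightarrow> 'e::banach) \<Rightarrow> ('x \<Rightarrow> 'e)) \<Rightarrow> bool" where
  "rich A \<longleftrightarrow> (\<forall>\<omega>\<in>nonprincipal_ultrafilters. rich_at A \<omega>)"

end

theory Submission
  imports Defs
begin

text \<open>
  On \<open>c\<^sub>0\<close>, \<open>\<ell>\<^sup>1\<close> and \<open>\<ell>\<^sup>\<infinity>\<close> the norm of an operator is governed by single columns (\<open>p = 1\<close>) or by
  single rows (\<open>p = 0, \<infinity>\<close>) of its matrix, so cutting the matrix off outside the strip
  \<open>d(x,y) \<le> R\<close> does not increase the norm. If \<open>B\<close> is a band operator of propagation at most \<open>R\<close>
  close to \<open>T\<close>, then the truncation \<open>C\<close> of \<open>T\<close> satisfies \<open>\<parallel>C - B\<parallel> \<le> \<parallel>T - B\<parallel>\<close>, hence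
  \<open>\<parallel>T - C\<parallel> \<le> 2 \<parallel>T - B\<parallel>\<close>. Finally \<open>C\<close> is as rich as \<open>T\<close>, because an ultrafilter decides
  whether \<open>d(t(x),s(x)) \<le> R\<close>.
\<close>

section \<open>The function spaces\<close>

lemma norm_le_ell_norm:
  assumes "f \<in> ell p" shows "norm (f x) \<le> ell_norm p f"
proof (cases p)
  case P0
  have "bounded (range f)"
  proof -
    have "eventually (\<lambda>x. dist (f x) 0 < 1) cofinite"
      using assms P0 by (auto dest: tendstoD[where e = 1])
    hence fin: "finite {x. \<not> norm (f x) < 1}" by (simp add: eventually_cofinite)
    \<comment> \<open>A supremum in \<open>real\<close> dominates its terms only when they are
      bounded above. Vanishing at infinity gives this: all but finitely many values lie in the unit
      ball.\<close>
    have "range f \<subseteq> f ` {x. \<not> norm (f x) < 1} \<union> ball 0 1" by auto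
    thus ?thesis using fin by (meson bounded_Un bounded_ball bounded_subset finite_imageI finite_imp_bounded)
  qed
  hence "bdd_above (range (\<lambda>x. norm (f x)))"
    by (auto simp: bounded_iff bdd_above_def)
  thus ?thesis using P0 by (auto intro: cSUP_upper)
next
  case P1
  have "(\<Sum>y\<in>{x}. norm (f y)) \<le> (\<Sum>\<^sub>\<infinity>y. norm (f y))"
    by (rule finite_sum_le_infsum) (use assms P1 in auto)
  thus ?thesis using P1 by simp
next
  case PInf
  hence "bdd_above (range (\<lambda>x. norm (f x)))"
    using assms by (auto simp: bounded_iff bdd_above_def)
  thus ?thesis using PInf by (auto intro: cSUP_upper)
qed

lemma ell_norm_nonneg: "f \<in> ell p \<Longrightarrow> 0 \<le> ell_norm p f"
  by (rule order_trans[OF norm_ge_zero norm_le_ell_norm])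

lemma ell_norm_sup_le:
  assumes "p \<noteq> P1" "\<And>x. norm (f x) \<le> K" shows "ell_norm p f \<le> K"
  using assms by (cases p) (auto intro: cSUP_least)

text \<open>Finite partial sums decide summability and the value of the norm together, so all
  \<open>P1\<close> estimates below concern finite sums.\<close>

lemma ell_norm_P1_le:
  assumes "\<And>F. finite F \<Longrightarrow> (\<Sum>x\<in>F. norm (f x)) \<le> K"
  shows "f \<in> ell P1" "ell_norm P1 f \<le> K"
proof -
  have "(\<lambda>x. norm (f x)) summable_on UNIV"
    by (rule nonneg_bdd_above_summable_on) (use assms in \<open>auto simp: bdd_above_def\<close>)
  thus "f \<in> ell P1" "ell_norm P1 f \<le> K"
    using assms by (auto intro: infsum_le_finite_sums)
qed

lemma sum_le_ell_norm_P1: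
  "f \<in> ell P1 \<Longrightarrow> finite F \<Longrightarrow> (\<Sum>x\<in>F. norm (f x)) \<le> ell_norm P1 f"
  by (auto intro: finite_sum_le_infsum)

lemma finite_support_ell:
  assumes "finite {x. f x \<noteq> 0}" shows "f \<in> ell p"
proof (cases p)
  case P0
  have "eventually (\<lambda>x. f x = 0) cofinite" using assms by (simp add: eventually_cofinite)
  thus ?thesis using P0 by (simp add: tendsto_eventually)
next
  case P1
  have "(\<lambda>x. norm (f x)) summable_on {x. f x \<noteq> 0}" using assms by simp
  hence "(\<lambda>x. norm (f x)) summable_on UNIV"
    by (rule summable_on_cong_neutral[THEN iffD1, rotated -1]) auto
  thus ?thesis using P1 by simp
next
  case PInf
  have "range f \<subseteq> insert 0 (f ` {x. f x \<noteq> 0})" by auto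
  thus ?thesis using PInf assms
    by simp (meson bounded_subset finite_imageI finite_imp_bounded finite_insert)
qed

text \<open>Each of the three spaces is solid. This covers negation, scalar multiples and cutting a
  function off outside a set.\<close>

lemma ell_comparison:
  assumes "f \<in> ell p" "\<And>x. norm (g x) \<le> c * norm (f x)" shows "g \<in> ell p"
proof (cases p)
  case P0
  show ?thesis using assms P0
    by (auto intro!: tendsto_0_le[where f = f and K = c and g = g] simp: mult.commute)
next
  case P1
  have "(\<lambda>x. c * norm (f x)) summable_on UNIV"
    using assms P1 by (auto intro: summable_on_cmult_right)
  hence "(\<lambda>x. norm (g x)) summable_on UNIV"
    by (rule summable_on_comparison_test) (use assms in auto)
  thus ?thesis using P1 by simp
next
  case PInf
  have "norm (g x) \<le> \<bar>c\<bar> * ell_norm p f" for x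
  proof -
    have "norm (g x) \<le> \<bar>c\<bar> * norm (f x)"
      by (rule order_trans[OF assms(2)]) (simp add: mult_right_mono)
    also have "\<dots> \<le> \<bar>c\<bar> * ell_norm p f"
      by (simp add: mult_left_mono norm_le_ell_norm[OF assms(1)])
    finally show ?thesis .
  qed
  thus ?thesis using PInf by (auto simp: bounded_iff)
qed

lemma
  assumes "f \<in> ell p" "g \<in> ell p"
  shows ell_add: "(\<lambda>x. f x + g x) \<in> ell p"
    and ell_norm_add: "ell_norm p (\<lambda>x. f x + g x) \<le> ell_norm p f + ell_norm p g"
proof -
  have sums: "(\<Sum>x\<in>F. norm (f x + g x)) \<le> ell_norm P1 f + ell_norm P1 g"
    if "p = P1" "finite F" for F
  proof -
    have "(\<Sum>x\<in>F. norm (f x + g x)) \<le> (\<Sum>x\<in>F. norm (f x)) + (\<Sum>x\<in>F. norm (g x))"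
      by (simp add: sum.distrib[symmetric] sum_mono norm_triangle_ineq)
    also have "\<dots> \<le> ell_norm P1 f + ell_norm P1 g"
      using assms that by (intro add_mono sum_le_ell_norm_P1) auto
    finally show ?thesis .
  qed
  have pw: "norm (f x + g x) \<le> ell_norm p f + ell_norm p g" for x
    by (rule norm_triangle_le) (intro add_mono norm_le_ell_norm assms)
  show "(\<lambda>x. f x + g x) \<in> ell p"
  proof (cases p)
    case P0
    thus ?thesis using assms tendsto_add[of f 0 cofinite g 0] by simp
  next
    case P1
    show ?thesis using ell_norm_P1_le(1)[OF sums[OF P1]] P1 by simp
  next
    case PInf
    thus ?thesis using pw by (auto simp: bounded_iff)
  qed
  show "ell_norm p (\<lambda>x. f x + g x) \<le> ell_norm p f + ell_norm p g"
  proof (cases "p = P1")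
    case True
    show ?thesis using ell_norm_P1_le(2)[OF sums[OF True]] True by simp
  next
    case False
    show ?thesis by (rule ell_norm_sup_le[OF False pw])
  qed
qed

lemma ell_norm_uminus: "ell_norm p (\<lambda>x. - f x) = ell_norm p f"
  by (cases p) auto

lemma
  assumes "f \<in> ell p" "g \<in> ell p"
  shows ell_diff: "(\<lambda>x. f x - g x) \<in> ell p"
    and ell_norm_diff: "ell_norm p (\<lambda>x. f x - g x) \<le> ell_norm p f + ell_norm p g"
proof -
  have "(\<lambda>x. - g x) \<in> ell p"
    by (rule ell_comparison[OF assms(2), where c = 1]) simp
  from ell_add[OF assms(1) this] ell_norm_add[OF assms(1) this]
  show "(\<lambda>x. f x - g x) \<in> ell p" "ell_norm p (\<lambda>x. f x - g x) \<le> ell_norm p f + ell_norm p g"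
    by (simp_all add: ell_norm_uminus)
qed

lemma delta_ell: "delta y e \<in> ell p"
  by (rule finite_support_ell, rule finite_subset[of _ "{y}"]) (auto simp: delta_def)

lemma ell_norm_delta: "ell_norm p (delta y e) \<le> norm e"
proof (cases "p = P1")
  case True
  have "(\<Sum>x\<in>F. norm (delta y e x)) \<le> norm e" if "finite F" for F
  proof -
    have "(\<Sum>x\<in>F. norm (delta y e x)) = (\<Sum>x\<in>F. if y = x then norm e else 0)"
      by (rule sum.cong) (auto simp: delta_def)
    thus ?thesis using that by simp
  qed
  from ell_norm_P1_le(2)[OF this] show ?thesis using True by simp
next
  case False
  thus ?thesis by (rule ell_norm_sup_le) (auto simp: delta_def)
qed

section \<open>Operator norms\<close>

lemma op_norm_le:
  assumes "0 \<le> K" "\<And>f. f \<in> ell p \<Longrightarrow> ell_norm p (T f) \<le> K * ell_norm p f"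
  shows "op_norm p T \<le> K"
  unfolding op_norm_def
proof (rule cSUP_least)
  show "ell p \<noteq> {}" using delta_ell[of undefined 0 p] by auto
  show "ell_norm p (T f) / ell_norm p f \<le> K" if "f \<in> ell p" for f
  \<comment> \<open>Division by 0 yields 0, so here the quotient is bounded by \<open>K\<close> only
    because \<open>0 \<le> K\<close>.\<close>
  proof (cases "ell_norm p f = 0")
    case False
    hence "0 < ell_norm p f" using ell_norm_nonneg[OF that] by simp
    thus ?thesis using assms(2)[OF that] by (simp add: divide_le_eq)
  qed (simp add: assms(1))
qed

text \<open>The a priori bound \<open>C\<close> makes the quotients bounded above; without it the
  supremum in \<open>op_norm\<close> would carry no information.\<close>

lemma
  assumes bd: "\<forall>f\<in>ell p. ell_norm p (T f) \<le> C * ell_norm p f"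
    and T: "\<forall>f\<in>ell p. T f \<in> ell p"
  shows le_op_norm: "f \<in> ell p \<Longrightarrow> ell_norm p (T f) \<le> op_norm p T * ell_norm p f"
    and op_norm_nonneg: "0 \<le> op_norm p T"
proof -
  have "ell_norm p (T f) / ell_norm p f \<le> \<bar>C\<bar>" if "f \<in> ell p" for f
  proof (cases "ell_norm p f = 0")
    case False
    hence "0 < ell_norm p f" using ell_norm_nonneg[OF that] by simp
    moreover have "ell_norm p (T f) \<le> \<bar>C\<bar> * ell_norm p f"
      using bd that calculation by (meson abs_ge_self mult_right_mono order_trans less_imp_le)
    ultimately show ?thesis by (simp add: divide_le_eq)
  qed simp
  hence bdd: "bdd_above ((\<lambda>f. ell_norm p (T f) / ell_norm p f) ` ell p)"
    by (auto simp: bdd_above_def)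
  have le: "ell_norm p (T f) / ell_norm p f \<le> op_norm p T" if "f \<in> ell p" for f
    unfolding op_norm_def by (rule cSUP_upper[OF that bdd])
  show "ell_norm p (T f) \<le> op_norm p T * ell_norm p f" if "f \<in> ell p"
  proof (cases "ell_norm p f = 0")
    \<comment> \<open>The quotient says nothing here, but the a priori bound forces
      \<open>T f\<close> to have norm 0.\<close>
    case True
    thus ?thesis using bd that by fastforce
  next
    case False
    hence "0 < ell_norm p f" using ell_norm_nonneg[OF that] by simp
    thus ?thesis using le[OF that] by (simp add: divide_le_eq)
  qed
  \<comment> \<open>One nonnegative quotient below the supremum suffices; \<open>delta y 0\<close>
    is a member of \<open>ell p\<close> at hand.\<close>
  have "0 \<le> ell_norm p (T (delta y 0)) / ell_norm p (delta y 0)" for y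
    by (intro divide_nonneg_nonneg ell_norm_nonneg T[rule_format] delta_ell)
  with le[OF delta_ell] show "0 \<le> op_norm p T" by (meson order_trans)
qed

section \<open>Truncation to a strip is a contraction\<close>

text \<open>This is the column half of the Schur test: interchanging the double sum leaves column
  sums weighted by \<open>norm (f y)\<close>. The general kernel \<open>k\<close> serves both for
  truncated operators and for bounded strip matrices.\<close>

lemma strip_sum_ell_P1:
  fixes k :: "'x::metric_space \<Rightarrow> 'x \<Rightarrow> 'e::real_normed_vector \<Rightarrow> 'e"
  assumes fin: "\<And>x. finite (cball x R :: 'x set)"
    and col: "\<And>y e. (\<Sum>x\<in>cball y R. norm (k x y e)) \<le> K * norm e"
    and f: "f \<in> ell P1" and K: "0 \<le> K"
  shows "(\<lambda>x. \<Sum>y\<in>cball x R. k x y (f y)) \<in> ell P1"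
    and "ell_norm P1 (\<lambda>x. \<Sum>y\<in>cball x R. k x y (f y)) \<le> K * ell_norm P1 f"
proof -
  have le: "(\<Sum>x\<in>F. norm (\<Sum>y\<in>cball x R. k x y (f y))) \<le> K * ell_norm P1 f" if F: "finite F" for F
  proof -
    \<comment> \<open>\<open>G\<close> contains every column that meets a row in \<open>F\<close>,
      so the double sum runs over the finite set F x G.\<close>
    define G where "G = (\<Union>x\<in>F. cball x R)"
    have G: "finite G" using F fin by (simp add: G_def)
    have "(\<Sum>x\<in>F. norm (\<Sum>y\<in>cball x R. k x y (f y)))
        \<le> (\<Sum>x\<in>F. \<Sum>y\<in>cball x R. norm (k x y (f y)))"
      by (intro sum_mono norm_sum)
    also have "\<dots> = (\<Sum>x\<in>F. \<Sum>y\<in>{y\<in>G. dist x y \<le> R}. norm (k x y (f y)))"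
      by (intro sum.cong refl) (auto simp: G_def)
    also have "\<dots> = (\<Sum>y\<in>G. \<Sum>x\<in>{x\<in>F. dist x y \<le> R}. norm (k x y (f y)))"
      by (rule sum.swap_restrict[OF F G])
    \<comment> \<open>The strip is symmetric, so the rows met by column \<open>y\<close> lie in the
      ball around \<open>y\<close>; the added terms are nonnegative.\<close>
    also have "\<dots> \<le> (\<Sum>y\<in>G. \<Sum>x\<in>cball y R. norm (k x y (f y)))"
      by (intro sum_mono sum_mono2 fin) (auto simp: dist_commute)
    also have "\<dots> \<le> (\<Sum>y\<in>G. K * norm (f y))"
      by (intro sum_mono col)
    also have "\<dots> \<le> K * ell_norm P1 f"
      unfolding sum_distrib_left[symmetric]
      by (intro mult_left_mono sum_le_ell_norm_P1 f G K)
    finally show ?thesis .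
  qed
  show "(\<lambda>x. \<Sum>y\<in>cball x R. k x y (f y)) \<in> ell P1"
    by (rule ell_norm_P1_le(1), rule le)
  show "ell_norm P1 (\<lambda>x. \<Sum>y\<in>cball x R. k x y (f y)) \<le> K * ell_norm P1 f"
    by (rule ell_norm_P1_le(2), rule le)
qed

text \<open>For \<open>P1\<close>, a truncated column is part of the full column
  \<open>D (delta y e)\<close>, whose norm is at most \<open>K * norm e\<close>. For the sup norms,
  the truncated operator at \<open>x\<close> agrees with \<open>D\<close> applied to
  \<open>f\<close> cut off outside the ball around \<open>x\<close>, and the cut does not increase
  the norm of \<open>f\<close>.\<close>

lemma strip_truncation_contractive:
  fixes D :: "('x::metric_space \<Rightarrow> 'e::real_normed_vector) \<Rightarrow> ('x \<Rightarrow> 'e)"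
  assumes fin: "\<And>x. finite (cball x R :: 'x set)"
    and D: "\<And>f. f \<in> ell p \<Longrightarrow> D f \<in> ell p"
    and add: "\<And>f g. f \<in> ell p \<Longrightarrow> g \<in> ell p \<Longrightarrow> D (\<lambda>x. f x + g x) = (\<lambda>x. D f x + D g x)"
    and bd: "\<And>f. f \<in> ell p \<Longrightarrow> ell_norm p (D f) \<le> K * ell_norm p f"
    and K: "0 \<le> K" and f: "f \<in> ell p"
  shows "ell_norm p (\<lambda>x. \<Sum>y\<in>cball x R. D (delta y (f y)) x) \<le> K * ell_norm p f"
proof (cases "p = P1")
  case True
  have "(\<Sum>x\<in>cball y R. norm (D (delta y e) x)) \<le> K * norm e" for y e
  proof -
    have "(\<Sum>x\<in>cball y R. norm (D (delta y e) x)) \<le> ell_norm P1 (D (delta y e))"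
      using D[OF delta_ell] True fin by (intro sum_le_ell_norm_P1) auto
    also have "\<dots> \<le> K * ell_norm P1 (delta y e)" using bd[OF delta_ell] True by simp
    also have "\<dots> \<le> K * norm e" by (intro mult_left_mono ell_norm_delta K)
    finally show ?thesis .
  qed
  from strip_sum_ell_P1(2)[of R "\<lambda>x y e. D (delta y e) x", OF fin this _ K] f True
  show ?thesis by simp
next
  case False
  show ?thesis
  proof (rule ell_norm_sup_le[OF False])
    fix x
    have cut: "(\<lambda>z. if z \<in> F then f z else 0) \<in> ell p" for F
      by (rule ell_comparison[OF f, where c = 1]) auto
    \<comment> \<open>Additivity gives D 0 = D 0 + D 0.\<close>
    have zero: "D (\<lambda>_. 0) = (\<lambda>_. 0)"
      using add[of "\<lambda>_. 0" "\<lambda>_. 0"] cut[of "{}"] by (simp add: fun_eq_iff)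
    \<comment> \<open>A finitely supported function is a finite sum of deltas, so finite additivity
      is enough; no continuity of \<open>D\<close> enters.\<close>
    have "D (\<lambda>z. if z \<in> F then f z else 0) x = (\<Sum>y\<in>F. D (delta y (f y)) x)" if "finite F" for F
      using that
    proof induction
      case empty
      show ?case by (simp add: zero)
    next
      case (insert y F)
      have "(\<lambda>z. if z \<in> insert y F then f z else 0)
          = (\<lambda>z. delta y (f y) z + (if z \<in> F then f z else 0))"
        using insert by (auto simp: delta_def fun_eq_iff)
      hence "D (\<lambda>z. if z \<in> insert y F then f z else 0) x
          = D (\<lambda>z. delta y (f y) z + (if z \<in> F then f z else 0)) x" by (rule arg_cong[where f = "\<lambda>g. D g x"])
      also have "\<dots> = D (delta y (f y)) x + D (\<lambda>z. if z \<in> F then f z else 0) x"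
        by (subst add[OF delta_ell cut]) (rule refl)
      also have "\<dots> = (\<Sum>z\<in>insert y F. D (delta z (f z)) x)"
        using insert by simp
      finally show ?case .
    qed
    hence "(\<Sum>y\<in>cball x R. D (delta y (f y)) x)
        = D (\<lambda>z. if z \<in> cball x R then f z else 0) x"
      by (rule sym) (rule fin)
    hence "norm (\<Sum>y\<in>cball x R. D (delta y (f y)) x)
        \<le> ell_norm p (D (\<lambda>z. if z \<in> cball x R then f z else 0))"
      using norm_le_ell_norm[OF D[OF cut]] by (rule ssubst[where P = "\<lambda>u. norm u \<le> _"])
    also have "\<dots> \<le> K * ell_norm p (\<lambda>z. if z \<in> cball x R then f z else 0)" by (rule bd[OF cut])
    also have "\<dots> \<le> K * ell_norm p f"
      by (intro mult_left_mono K ell_norm_sup_le[OF False])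
         (auto simp: norm_le_ell_norm[OF f] ell_norm_nonneg[OF f])
    finally show "norm (\<Sum>y\<in>cball x R. D (delta y (f y)) x) \<le> K * ell_norm p f" .
  qed
qed

section \<open>Band matrices\<close>

lemma bounded_geometry_cball:
  assumes "bounded_geometry (UNIV :: 'x::metric_space set)"
  obtains N where "\<And>x::'x. finite (cball x R)" "\<And>x::'x. card (cball x R) \<le> N"
  using assms unfolding bounded_geometry_def by (metis Int_UNIV_left UNIV_I)

text \<open>The index set now depends on \<open>R\<close> alone and not on the matrix, so sums for
  different matrices can be subtracted term by term.\<close>

lemma matrix_op_eq_cball_sum:
  assumes "finite (cball x R)" "\<forall>x y. A x y \<noteq> 0 \<longrightarrow> dist x y \<le> R" "f \<in> ell p"
  shows "matrix_op p A f x = (\<Sum>y\<in>cball x R. blinfun_apply (A x y) (f y))"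
  unfolding matrix_op_def using assms
  by (auto intro!: sum.mono_neutral_left)

lemma band_matrixE:
  assumes "band_matrix sc A"
  obtains M R where "0 \<le> M" "\<forall>x y. norm (A x y) \<le> M" "\<forall>x y. A x y \<noteq> 0 \<longrightarrow> dist x y \<le> R"
proof -
  from assms obtain M where M: "\<forall>z\<in>{norm (A x y) |x y. True}. z \<le> M"
    unfolding band_matrix_def bdd_above_def by blast
  from assms obtain R where R: "\<forall>z\<in>{dist x y |x y. A x y \<noteq> 0}. z \<le> R"
    unfolding band_matrix_def bdd_above_def by blast
  show thesis
  proof (rule that)
    show M': "\<forall>x y. norm (A x y) \<le> M" using M by blast
    show "0 \<le> M" by (rule order_trans[OF norm_ge_zero M'[rule_format]])
    show "\<forall>x y. A x y \<noteq> 0 \<longrightarrow> dist x y \<le> R" using R by blast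
  qed
qed

text \<open>By symmetry of the distance, \<open>N\<close> bounds the number of strip entries in each
  row and in each column. Rows give the sup estimates, columns the \<open>P1\<close>
  estimate.\<close>

lemma strip_matrix_bounded:
  fixes A :: "'x::metric_space \<Rightarrow> 'x \<Rightarrow> ('e::banach \<Rightarrow>\<^sub>L 'e)"
  assumes fin: "\<And>x. finite (cball x R :: 'x set)" and N: "\<And>x::'x. card (cball x R) \<le> N"
    and M: "0 \<le> M" "\<forall>x y. norm (A x y) \<le> M"
    and f: "f \<in> ell p"
  shows "(\<lambda>x. \<Sum>y\<in>cball x R. blinfun_apply (A x y) (f y)) \<in> ell p"
    and "ell_norm p (\<lambda>x. \<Sum>y\<in>cball x R. blinfun_apply (A x y) (f y)) \<le> N * M * ell_norm p f"
proof -
  let ?S = "\<lambda>x. \<Sum>y\<in>cball x R. blinfun_apply (A x y) (f y)"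
  have ap: "norm (blinfun_apply (A x y) e) \<le> M * norm e" for x y e
    by (meson M(2) mult_right_mono norm_blinfun norm_ge_zero order_trans)
  have const: "(\<Sum>y\<in>cball x R. M * c) \<le> N * M * c" if "0 \<le> c" for c and x :: 'x
    using mult_right_mono[of "real (card (cball x R))" "real N" "M * c"] N[of x] that M(1)
    by (simp add: mult.assoc)
  \<comment> \<open>Kept local to the ball around \<open>x\<close>: a global \<open>c\<close> gives
    the sup bound, a small \<open>c\<close> gives decay in the \<open>P0\<close> case.\<close>
  have pt: "norm (?S x) \<le> N * M * c" if "\<And>y. y \<in> cball x R \<Longrightarrow> norm (f y) \<le> c" "0 \<le> c" for c x
  proof -
    have "norm (?S x) \<le> (\<Sum>y\<in>cball x R. M * c)"
      by (intro sum_norm_le order_trans[OF ap] mult_left_mono M(1) that)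
    thus ?thesis using const[OF that(2)] by (rule order_trans)
  qed
  have sup: "norm (?S x) \<le> N * M * ell_norm p f" for x
    by (rule pt) (auto simp: norm_le_ell_norm[OF f] ell_norm_nonneg[OF f])
  have "?S \<in> ell p \<and> ell_norm p ?S \<le> N * M * ell_norm p f"
  proof (cases p)
    case P1
    have "(\<Sum>x\<in>cball y R. norm (blinfun_apply (A x y) e)) \<le> N * M * norm e" for y e
    proof -
      have "(\<Sum>x\<in>cball y R. norm (blinfun_apply (A x y) e)) \<le> (\<Sum>x\<in>cball y R. M * norm e)"
        by (intro sum_mono ap)
      thus ?thesis using const[OF norm_ge_zero] by (rule order_trans)
    qed
    from strip_sum_ell_P1[of R "\<lambda>x y. blinfun_apply (A x y)", OF fin this] f P1 M(1)
    show ?thesis by simp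
  next
    case PInf
    thus ?thesis using sup by (auto simp: bounded_iff intro: cSUP_least)
  next
    case P0
    have "eventually (\<lambda>x. dist (?S x) 0 < \<epsilon>) cofinite" if "0 < \<epsilon>" for \<epsilon>
    proof -
      \<comment> \<open>Adding 1 keeps the denominator positive when \<open>N * M = 0\<close> and
        makes \<open>N * M * c < \<epsilon>\<close> strict.\<close>
      define c where "c = \<epsilon> / (N * M + 1)"
      have NM: "0 \<le> N * M" using M(1) by simp
      hence c: "0 < c" "N * M * c < \<epsilon>" using that
        by (auto simp: c_def divide_simps algebra_simps add_pos_nonneg)
      have "finite {y. \<not> dist (f y) 0 < c}"
        using f P0 c(1) tendstoD[of f 0 cofinite c] by (simp add: eventually_cofinite)
      \<comment> \<open>\<open>f\<close> is large at finitely many points only, and the sum at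
        \<open>x\<close> sees such a point only from within distance \<open>R\<close>.\<close>
      hence "finite (\<Union>y\<in>{y. \<not> norm (f y) < c}. cball y R)" using fin by simp
      moreover have "{x. \<not> norm (?S x) < \<epsilon>} \<subseteq> (\<Union>y\<in>{y. \<not> norm (f y) < c}. cball y R)"
      proof
        fix x assume x: "x \<in> {x. \<not> norm (?S x) < \<epsilon>}"
        show "x \<in> (\<Union>y\<in>{y. \<not> norm (f y) < c}. cball y R)"
        proof (rule ccontr)
          assume "\<not> ?thesis"
          hence "norm (?S x) \<le> N * M * c"
            using c(1) by (intro pt) (force simp: dist_commute)+
          thus False using x c(2) by simp
        qed
      qed
      ultimately show ?thesis by (simp add: eventually_cofinite finite_subset)
    qed
    hence "(?S \<longlongrightarrow> 0) cofinite" by (rule tendstoI)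
    thus ?thesis using P0 sup by (auto intro: cSUP_least)
  qed
  thus "?S \<in> ell p" "ell_norm p ?S \<le> N * M * ell_norm p f" by auto
qed

section \<open>Band operators as bounded and band-dominated operators\<close>

lemma band_ops_subset_bounded_ops:
  fixes sc :: "'k::real_normed_field \<Rightarrow> 'e::banach \<Rightarrow> 'e"
  assumes bg: "bounded_geometry (UNIV :: 'x::metric_space set)" and sc: "banach_scalars sc"
  shows "(band_ops sc p :: (('x \<Rightarrow> 'e) \<Rightarrow> ('x \<Rightarrow> 'e)) set) \<subseteq> bounded_ops sc p"
proof
  fix B :: "('x \<Rightarrow> 'e) \<Rightarrow> ('x \<Rightarrow> 'e)" assume "B \<in> band_ops sc p"
  then obtain A where A: "band_matrix sc A" and B: "B = matrix_op p A"
    by (auto simp: band_ops_def)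
  obtain M R where M: "0 \<le> M" "\<forall>x y. norm (A x y) \<le> M"
    and R: "\<forall>x y. A x y \<noteq> 0 \<longrightarrow> dist x y \<le> R" using band_matrixE[OF A] by blast
  obtain N where fin: "\<And>x::'x. finite (cball x R)" and N: "\<And>x::'x. card (cball x R) \<le> N"
    using bounded_geometry_cball[OF bg, of R] by blast
  have eq: "B f = (\<lambda>x. \<Sum>y\<in>cball x R. blinfun_apply (A x y) (f y))" if "f \<in> ell p" for f
    unfolding B by (rule ext, rule matrix_op_eq_cball_sum[OF fin R that])
  interpret vector_space sc using sc by (simp add: banach_scalars_def)
  have lin: "blinfun_apply (A x y) (sc c e) = sc c (blinfun_apply (A x y) e)" for x y c e
    using A by (auto simp: band_matrix_def bounded_ops_E_def)
  have scell: "(\<lambda>x. sc c (f x)) \<in> ell p" if "f \<in> ell p" for c and f :: "'x \<Rightarrow> 'e"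
    by (rule ell_comparison[OF that, where c = "norm c"]) (use sc in \<open>simp add: banach_scalars_def\<close>)
  note bounded = strip_matrix_bounded[OF fin N M]
  show "B \<in> bounded_ops sc p"
    unfolding bounded_ops_def
  proof (intro CollectI conjI ballI allI)
    show "B \<in> extensional (ell p)" by (simp add: B matrix_op_def)
    show "B f \<in> ell p" if "f \<in> ell p" for f
      using bounded(1)[OF that] eq[OF that] by simp
    show "B (\<lambda>x. f x + g x) = (\<lambda>x. B f x + B g x)" if "f \<in> ell p" "g \<in> ell p" for f g
      by (simp add: eq that ell_add blinfun.add_right sum.distrib)
    show "B (\<lambda>x. sc c (f x)) = (\<lambda>x. sc c (B f x))" if "f \<in> ell p" for c f
      by (simp add: eq that scell lin scale_sum_right)
    show "\<exists>C. \<forall>f\<in>ell p. ell_norm p (B f) \<le> C * ell_norm p f"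
      using bounded(2) eq by auto
  qed
qed

lemma bounded_opsE:
  assumes "T \<in> bounded_ops sc p"
  obtains C where "\<forall>f\<in>ell p. ell_norm p (T f) \<le> C * ell_norm p f" "0 \<le> C"
proof -
  obtain C where C: "\<forall>f\<in>ell p. ell_norm p (T f) \<le> C * ell_norm p f"
    using assms by (auto simp: bounded_ops_def)
  have "ell_norm p (T f) \<le> \<bar>C\<bar> * ell_norm p f" if "f \<in> ell p" for f
    using C[rule_format, OF that] mult_right_mono[OF abs_ge_self ell_norm_nonneg[OF that], of C]
    by linarith
  thus thesis using that[of "\<bar>C\<bar>"] by simp
qed

lemma op_norm_zero: "op_norm p (\<lambda>(f :: 'x \<Rightarrow> 'e::real_normed_vector) x. 0) = 0"
proof -
  have "ell_norm p (\<lambda>x::'x. 0::'e) = 0" by (cases p) auto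
  moreover have "(SUP f\<in>(ell p :: ('x \<Rightarrow> 'e) set). 0::real) = 0"
    using delta_ell[of undefined 0 p] by (intro cSUP_const) auto
  ultimately show ?thesis unfolding op_norm_def by (simp only: div_0)
qed

lemma band_ops_subset_band_dominated:
  fixes sc :: "'k::real_normed_field \<Rightarrow> 'e::banach \<Rightarrow> 'e"
  assumes "bounded_geometry (UNIV :: 'x::metric_space set)" "banach_scalars sc"
  shows "(band_ops sc p :: (('x \<Rightarrow> 'e) \<Rightarrow> ('x \<Rightarrow> 'e)) set) \<subseteq> band_dominated sc p"
proof
  fix B :: "('x \<Rightarrow> 'e) \<Rightarrow> ('x \<Rightarrow> 'e)" assume B: "B \<in> band_ops sc p"
  hence "B \<in> bounded_ops sc p" using band_ops_subset_bounded_ops[OF assms] by blast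
  moreover have "op_norm p (\<lambda>f x. B f x - B f x) = 0" by (simp add: op_norm_zero)
  ultimately show "B \<in> band_dominated sc p"
    unfolding band_dominated_def norm_closure_def using B by force
qed

section \<open>Matrix coefficients and truncations\<close>

text \<open>\<open>Blinfun\<close> is meaningful only on bounded linear maps, so
  \<open>matrix_coeff\<close> is usable once each entry of \<open>T\<close> is shown to be
  one.\<close>

lemma
  assumes sc: "banach_scalars sc" and T: "T \<in> bounded_ops sc p"
    and bd: "\<forall>f\<in>ell p. ell_norm p (T f) \<le> C * ell_norm p f" and C: "0 \<le> C"
  shows matrix_coeff_apply: "blinfun_apply (matrix_coeff T x y) e = T (delta y e) x"
    and norm_matrix_coeff_le: "norm (matrix_coeff T x y) \<le> C"
    and matrix_coeff_in_bounded_ops_E: "matrix_coeff T x y \<in> bounded_ops_E sc"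
proof -
  interpret vector_space sc using sc by (simp add: banach_scalars_def)
  have add: "T (delta y (a + b)) x = T (delta y a) x + T (delta y b) x" for a b
  proof -
    have "delta y (a + b) = (\<lambda>z. delta y a z + delta y b z)" by (auto simp: delta_def)
    thus ?thesis using T delta_ell[of y a p] delta_ell[of y b p] by (simp add: bounded_ops_def)
  qed
  have scale: "T (delta y (sc c a)) x = sc c (T (delta y a) x)" for c a
  proof -
    have "delta y (sc c a) = (\<lambda>z. sc c (delta y a z))" by (auto simp: delta_def)
    thus ?thesis using T delta_ell[of y a p] by (simp add: bounded_ops_def)
  qed
  have nm: "norm (T (delta y a) x) \<le> C * norm a" for a
  proof -
    have "T (delta y a) \<in> ell p" using T delta_ell[of y a p] by (simp add: bounded_ops_def)
    hence "norm (T (delta y a) x) \<le> ell_norm p (T (delta y a))" by (rule norm_le_ell_norm)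
    also have "\<dots> \<le> C * ell_norm p (delta y a)" by (rule bd[rule_format, OF delta_ell])
    also have "\<dots> \<le> C * norm a" by (intro mult_left_mono ell_norm_delta C)
    finally show ?thesis .
  qed
  have "bounded_linear (\<lambda>e. T (delta y e) x)"
  proof (rule bounded_linear_intro[where K = C])
    \<comment> \<open>Real homogeneity is the case of scalars \<open>of_real r\<close>.\<close>
    show "T (delta y (r *\<^sub>R a)) x = r *\<^sub>R T (delta y a) x" for r a
      using scale[of "of_real r" a] sc by (simp add: banach_scalars_def)
  qed (use add nm in \<open>auto simp: mult.commute\<close>)
  hence ap: "blinfun_apply (matrix_coeff T x y) e = T (delta y e) x" for e
    unfolding matrix_coeff_def by (simp add: bounded_linear_Blinfun_apply)
  show "blinfun_apply (matrix_coeff T x y) e = T (delta y e) x" by (rule ap)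
  show "norm (matrix_coeff T x y) \<le> C" by (rule norm_blinfun_bound[OF C]) (simp add: ap nm)
  show "matrix_coeff T x y \<in> bounded_ops_E sc" by (simp add: bounded_ops_E_def ap scale)
qed

lemma matrix_coeff_matrix_op:
  fixes A :: "'x::metric_space \<Rightarrow> 'x \<Rightarrow> ('e::banach \<Rightarrow>\<^sub>L 'e)"
  assumes fin: "\<And>x::'x. finite (cball x R)" and R: "\<forall>x y. A x y \<noteq> 0 \<longrightarrow> dist x y \<le> R"
  shows "matrix_coeff (matrix_op p A) = A"
proof (intro ext)
  fix x y
  have "matrix_op p A (delta y e) x = blinfun_apply (A x y) e" for e
  proof -
    have "matrix_op p A (delta y e) x
        = (\<Sum>z\<in>cball x R. if y = z then blinfun_apply (A x y) e else 0)"
      unfolding matrix_op_eq_cball_sum[OF fin R delta_ell]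
      by (rule sum.cong) (auto simp: delta_def)
    also have "\<dots> = blinfun_apply (A x y) e"
      \<comment> \<open>A nonzero entry puts \<open>y\<close> in the ball, so the sum contains its
        index; a zero entry contributes 0 either way.\<close>
      by (cases "A x y = 0") (use fin R in auto)
    finally show ?thesis .
  qed
  thus "matrix_coeff (matrix_op p A) x y = A x y"
    unfolding matrix_coeff_def by (simp add: blinfun_apply_inverse)
qed

section \<open>Richness under truncation, and density\<close>

lemma rich_at_truncation:
  assumes \<omega>: "\<omega> \<in> ultrafilters" and T: "rich_at T \<omega>"
    and S: "\<And>x y. matrix_coeff S x y = (if dist x y \<le> R then matrix_coeff T x y else 0)"
  shows "rich_at S \<omega>"
  unfolding rich_at_def
proof (intro allI impI)
  fix D R' t D' R'' s
  assume "partial_translation D R' t \<and> compatible D \<omega> \<and>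
    partial_translation D' R'' s \<and> compatible D' \<omega>"
  then obtain L where L: "((\<lambda>x. matrix_coeff T (t x) (s x)) \<longlongrightarrow> L) \<omega>"
    using T unfolding rich_at_def by blast
  \<comment> \<open>In the first case the coefficients of \<open>S\<close> eventually agree with
    those of \<open>T\<close> and keep the limit \<open>L\<close>; in the second they are eventually
    0.\<close>
  from \<omega> consider "\<forall>\<^sub>F x in \<omega>. dist (t x) (s x) \<le> R" | "\<forall>\<^sub>F x in \<omega>. \<not> dist (t x) (s x) \<le> R"
    unfolding ultrafilters_def by blast
  thus "\<exists>L. ((\<lambda>x. matrix_coeff S (t x) (s x)) \<longlongrightarrow> L) \<omega>"
  proof cases
    case 1
    hence "\<forall>\<^sub>F x in \<omega>. matrix_coeff T (t x) (s x) = matrix_coeff S (t x) (s x)"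
      by (rule eventually_mono) (simp add: S)
    from tendsto_cong[OF this] L show ?thesis by auto
  next
    case 2
    hence "\<forall>\<^sub>F x in \<omega>. matrix_coeff S (t x) (s x) = 0"
      by (rule eventually_mono) (simp add: S)
    from tendsto_eventually[OF this] show ?thesis by auto
  qed
qed

text \<open>The approximating band operator \<open>B\<close> supplies only the radius
  \<open>R\<close>; the entries of \<open>S\<close> come from \<open>T\<close>, so that
  \<open>S\<close> can inherit richness, which \<open>B\<close> need not have.\<close>

lemma band_dominated_approx_by_truncation:
  fixes sc :: "'k::real_normed_field \<Rightarrow> 'e::banach \<Rightarrow> 'e"
    and T :: "('x::metric_space \<Rightarrow> 'e) \<Rightarrow> ('x \<Rightarrow> 'e)"
  assumes bg: "bounded_geometry (UNIV :: 'x set)" and sc: "banach_scalars sc"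
    and T: "T \<in> band_dominated sc p" and \<epsilon>: "0 < \<epsilon>"
  obtains S R where "S \<in> band_ops sc p" "op_norm p (\<lambda>f x. T f x - S f x) < \<epsilon>"
    "\<And>x y. matrix_coeff S x y = (if dist x y \<le> R then matrix_coeff T x y else 0)"
proof -
  have Tb: "T \<in> bounded_ops sc p" using T by (simp add: band_dominated_def norm_closure_def)
  \<comment> \<open>Half of \<open>\<epsilon>\<close>, because the distance to \<open>B\<close> is
    spent twice: on T - B and on its truncation S - B.\<close>
  obtain B where B: "B \<in> band_ops sc p" and TB: "op_norm p (\<lambda>f x. T f x - B f x) < \<epsilon> / 2"
    using T \<epsilon> half_gt_zero[OF \<epsilon>] unfolding band_dominated_def norm_closure_def by blast
  have Bb: "B \<in> bounded_ops sc p" using B band_ops_subset_bounded_ops[OF bg sc] by blast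
  from B obtain A where A: "band_matrix sc A" and BA: "B = matrix_op p A"
    by (auto simp: band_ops_def)
  obtain R where R: "\<forall>x y. A x y \<noteq> 0 \<longrightarrow> dist x y \<le> R"
    by (rule band_matrixE[OF A])
  have fin: "finite (cball x R)" for x :: 'x using bounded_geometry_cball[OF bg, of R] by blast
  define D where "D = (\<lambda>f x. T f x - B f x)"
  define K where "K = op_norm p D"
  have D: "\<forall>f\<in>ell p. D f \<in> ell p"
    unfolding D_def using Tb Bb by (auto intro!: ell_diff simp: bounded_ops_def)
  have add: "D (\<lambda>x. f x + g x) = (\<lambda>x. D f x + D g x)" if "f \<in> ell p" "g \<in> ell p" for f g
    using that Tb Bb by (simp add: bounded_ops_def D_def fun_eq_iff)
  obtain CT where CT: "\<forall>f\<in>ell p. ell_norm p (T f) \<le> CT * ell_norm p f" and CT0: "0 \<le> CT"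
    by (rule bounded_opsE[OF Tb])
  obtain CB where CB: "\<forall>f\<in>ell p. ell_norm p (B f) \<le> CB * ell_norm p f" and CB0: "0 \<le> CB"
    by (rule bounded_opsE[OF Bb])
  have "\<forall>f\<in>ell p. ell_norm p (D f) \<le> (CT + CB) * ell_norm p f"
  proof
    fix f :: "'x \<Rightarrow> 'e" assume that: "f \<in> ell p"
    have "ell_norm p (D f) \<le> ell_norm p (T f) + ell_norm p (B f)"
      unfolding D_def using that Tb Bb by (intro ell_norm_diff) (auto simp: bounded_ops_def)
    thus "ell_norm p (D f) \<le> (CT + CB) * ell_norm p f"
      using CT[rule_format, OF that] CB[rule_format, OF that] by (simp add: distrib_right)
  qed
  note DK = le_op_norm[of p D, OF this D, folded K_def] op_norm_nonneg[of p D, OF this D, folded K_def]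
  note coeff = matrix_coeff_apply[OF sc Tb CT CT0]
    norm_matrix_coeff_le[OF sc Tb CT CT0]
    matrix_coeff_in_bounded_ops_E[OF sc Tb CT CT0]
  define C where "C = (\<lambda>x y. if dist x y \<le> R then matrix_coeff T x y else 0)"
  define S where "S = matrix_op p C"
  have CR: "\<forall>x y. C x y \<noteq> 0 \<longrightarrow> dist x y \<le> R" by (simp add: C_def)
  \<comment> \<open>Supplies \<open>sc c 0 = 0\<close>, by which the zero entries of
    \<open>C\<close> are linear over the scalars.\<close>
  interpret vector_space sc using sc by (simp add: banach_scalars_def)
  have "band_matrix sc C"
    unfolding band_matrix_def
  proof (intro conjI allI)
    show "C x y \<in> bounded_ops_E sc" for x y
      using coeff(3) by (auto simp: C_def bounded_ops_E_def)
    show "bdd_above {norm (C x y) |x y. True}"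
      using coeff(2) CT0 by (auto simp: C_def bdd_above_def intro!: exI[of _ CT])
    show "bdd_above {dist x y |x y. C x y \<noteq> 0}"
      using CR by (auto simp: bdd_above_def)
  qed
  hence S: "S \<in> band_ops sc p" by (simp add: band_ops_def S_def)
  hence Sb: "S \<in> bounded_ops sc p" using band_ops_subset_bounded_ops[OF bg sc] by blast
  have B_delta: "B (delta y e) x = blinfun_apply (A x y) e" for x y e
    using matrix_coeff_apply[OF sc Bb CB CB0, of x y e]
      matrix_coeff_matrix_op[OF fin R, of p] BA by simp
  \<comment> \<open>\<open>B\<close> has no entries outside the strip, so it is its own truncation
    and S - B is the truncation of D = T - B.\<close>
  have SB: "(\<lambda>x. S f x - B f x) = (\<lambda>x. \<Sum>y\<in>cball x R. D (delta y (f y)) x)" if "f \<in> ell p" for f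
    unfolding S_def BA matrix_op_eq_cball_sum[OF fin CR that] matrix_op_eq_cball_sum[OF fin R that]
      sum_subtractf[symmetric]
    by (intro ext sum.cong refl) (simp add: D_def B_delta C_def coeff(1))
  have "op_norm p (\<lambda>f x. T f x - S f x) \<le> 2 * K"
  proof (rule op_norm_le)
    fix f :: "'x \<Rightarrow> 'e" assume f: "f \<in> ell p"
    have SBf: "(\<lambda>x. S f x - B f x) \<in> ell p"
      using f Sb Bb by (intro ell_diff) (auto simp: bounded_ops_def)
    have "ell_norm p (\<lambda>x. T f x - S f x) = ell_norm p (\<lambda>x. D f x - (S f x - B f x))"
      by (simp add: D_def)
    also have "\<dots> \<le> ell_norm p (D f) + ell_norm p (\<lambda>x. S f x - B f x)"
      by (rule ell_norm_diff[OF D[rule_format, OF f] SBf])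
    also have "\<dots> \<le> K * ell_norm p f + K * ell_norm p f"
      unfolding SB[OF f]
      by (intro add_mono DK(1) strip_truncation_contractive fin D[rule_format] add DK(2) f)
    finally show "ell_norm p (\<lambda>x. T f x - S f x) \<le> 2 * K * ell_norm p f" by simp
  qed (use DK(2) in simp)
  moreover have "2 * K < \<epsilon>" using TB by (simp add: K_def D_def)
  ultimately have "op_norm p (\<lambda>f x. T f x - S f x) < \<epsilon>" by simp
  moreover have "matrix_coeff S x y = (if dist x y \<le> R then matrix_coeff T x y else 0)" for x y
    unfolding S_def matrix_coeff_matrix_op[OF fin CR] by (simp add: C_def)
  ultimately show thesis using S that by blast
qed

text \<open>Richness enters only as a property \<open>P\<close> inherited by truncations, so one
  argument yields both halves of the theorem.\<close>

lemma norm_dense_in_band_dominated: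
  fixes sc :: "'k::real_normed_field \<Rightarrow> 'e::banach \<Rightarrow> 'e"
  assumes bg: "bounded_geometry (UNIV :: 'x::metric_space set)" and sc: "banach_scalars sc"
    and P: "\<And>(T :: ('x \<Rightarrow> 'e) \<Rightarrow> 'x \<Rightarrow> 'e) S R. P T \<Longrightarrow>
      (\<And>x y. matrix_coeff S x y = (if dist x y \<le> R then matrix_coeff T x y else 0)) \<Longrightarrow> P S"
  shows "norm_dense_in sc p {A \<in> band_ops sc p. P A} {A \<in> band_dominated sc p. P A}"
  unfolding norm_dense_in_def
proof
  show "{A \<in> band_ops sc p. P A} \<subseteq> {A \<in> band_dominated sc p. P A}"
    using band_ops_subset_band_dominated[OF bg sc] by blast
  show "{A \<in> band_dominated sc p. P A} \<subseteq> norm_closure sc p {A \<in> band_ops sc p. P A}"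
  proof
    fix T assume T: "T \<in> {A \<in> band_dominated sc p. P A}"
    hence Td: "T \<in> band_dominated sc p" and PT: "P T" by auto
    have "\<exists>S\<in>{A \<in> band_ops sc p. P A}. op_norm p (\<lambda>f x. T f x - S f x) < \<epsilon>"
      if \<epsilon>: "0 < \<epsilon>" for \<epsilon>
    proof -
      obtain S R where "S \<in> band_ops sc p" "op_norm p (\<lambda>f x. T f x - S f x) < \<epsilon>"
        "\<And>x y. matrix_coeff S x y = (if dist x y \<le> R then matrix_coeff T x y else 0)"
        using band_dominated_approx_by_truncation[OF bg sc Td \<epsilon>] by blast
      with P[OF PT] show ?thesis by blast
    qed
    moreover have "T \<in> bounded_ops sc p"
      using Td by (simp add: band_dominated_def norm_closure_def)
    ultimately show "T \<in> norm_closure sc p {A \<in> band_ops sc p. P A}"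
      by (simp add: norm_closure_def)
  qed
qed

theorem theorem3p13:
  fixes sc :: "'k::real_normed_field \<Rightarrow> 'e::banach \<Rightarrow> 'e"
    and p :: exponent
  assumes "strongly_discrete (UNIV :: 'x::metric_space set)"
    and "bounded_geometry (UNIV :: 'x set)"
    and "banach_scalars sc"
  shows "(\<forall>\<omega> \<in> (nonprincipal_ultrafilters :: 'x filter set).
            norm_dense_in sc p
              {A \<in> band_ops sc p. rich_at A \<omega>}
              {A \<in> band_dominated sc p. rich_at A \<omega>})
       \<and> norm_dense_in sc p
            {A \<in> (band_ops sc p :: (('x \<Rightarrow> 'e) \<Rightarrow> ('x \<Rightarrow> 'e)) set). rich A}
            {A \<in> band_dominated sc p. rich A}"
proof -
  have trunc: "rich_at S \<omega>"
    if "\<omega> \<in> nonprincipal_ultrafilters" "rich_at T \<omega>"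
      "\<And>x y. matrix_coeff S x y = (if dist x y \<le> R then matrix_coeff T x y else 0)"
    for \<omega> :: "'x filter" and R and S T :: "('x \<Rightarrow> 'e) \<Rightarrow> ('x \<Rightarrow> 'e)"
    using rich_at_truncation[OF _ that(2,3)] that(1) by (simp add: nonprincipal_ultrafilters_def)
  show ?thesis
    \<comment> \<open>\<open>P\<close> is richness at a fixed \<open>\<omega>\<close>, then richness
      everywhere; since \<open>R\<close> does not depend on \<open>\<omega>\<close>, one truncation
      serves all ultrafilters at once.\<close>
    by (intro conjI ballI norm_dense_in_band_dominated[OF assms(2,3)])
       (auto simp: rich_def intro: trunc)
qed

end
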